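(* Consider an explicit Runge--Kutta method with $s\in\mathbb{N}$ stages and stability function $R$. Then the Runge--Kutta scheme is strongly stable if and only if it is strongly stable with respect to both of the following sets: (a) the set $\mathcal{L}_{AS}$ of all asymptotically stable, semi-dissipative matrices $\mathbf{L}\in\mathbb{C}^{n\times n}$, of any dimension $n\in\mathbb{N}$; and (b) the set $\mathcal{L}_{IM}$ of purely imaginary scalars $\mathbf{L}\in \mathrm{i}\mathbb{R}\subset\mathbb{C}=\mathbb{C}^{1\times 1}$. Here strong stability with respect to $\mathcal{L}_{AS}$ (resp. $\mathcal{L}_{IM}$) means that for every $\mathbf{L}$ in this set the numerical solution satisfies, for all sufficiently small time steps, $\|u^1\|\le\|u^0\|$ in the Euclidean norm for all initial data $u^0\in\mathbb{C}^n$.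
   Context: Runge--Kutta scheme: for the linear system $\frac{du}{dt}=\mathbf{L}u$, $u(0)=u^0\in\mathbb{C}^n$, with $\mathbf{L}\in\mathbb{C}^{n\times n}$, and a uniform time step $\tau>0$, an explicit Runge--Kutta method with $s\in\mathbb{N}$ stages, weights $b_i\in\mathbb{C}$ and coefficients $a_{ij}\in\mathbb{C}$ is $$u^k=u^{k-1}+\tau\sum_{i=1}^s b_iK_i^k,\qquad K_i^k=\mathbf{L}\Big(u^{k-1}+\tau\sum_{j=1}^{i-1}a_{ij}K_j^k\Big),\quad i=1,\dots,s.$$ It can be written as $u^k=R(\tau\mathbf{L})u^{k-1}$ with a polynomial $R$ (depending only on $b_i,a_{ij}$) called the stability function. Matrix notions: $\mathbf{L}\in\mathbb{C}^{n\times n}$ is Lyapunov stable if all its eigenvalues have nonpositive real part and those with zero real part are non-defective (algebraic and geometric multiplicities coincide); equivalently, there is a positive definite Hermitian $\mathbf{P}\in\mathbb{C}^{n\times n}$ with $\mathbf{L}^*\mathbf{P}+\mathbf{P}\mathbf{L}\le 0$. It is asymptotically stable if all eigenvalues have negative real part. It is semi-dissipative if its Hermitian part $(\mathbf{L}+\mathbf{L}^* )/2$ is negative semi-definite. Norms: $\|\cdot\|$ is the Euclidean norm on $\mathbb{C}^n$, and for positive definite Hermitian $\mathbf{P}$, $\|u\|_{\mathbf{P}}=\sqrt{\langle u,\mathbf{P}u\rangle}$. Strong stability: the scheme is strongly stable if for all $n\in\mathbb{N}$, all Lyapunov stable $\mathbf{L}\in\mathbb{C}^{n\times n}$, and all positive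 definite Hermitian $\mathbf{P}\in\mathbb{C}^{n\times n}$ with $\mathbf{L}^*\mathbf{P}+\mathbf{P}\mathbf{L}\le0$, one has $\|u^1\|_{\mathbf{P}}\le\|u^0\|_{\mathbf{P}}$ for all $u^0\in\mathbb{C}^n$ and all sufficiently small time steps, i.e. there is $\tau_0>0$ (which may depend on $\mathbf{L}$ and $\mathbf{P}$) such that $\|R(\tau\mathbf{L})u^0\|_{\mathbf{P}}\le\|u^0\|_{\mathbf{P}}$ for all $0<\tau\le\tau_0$ and all $u^0\in\mathbb{C}^n$. In the same way, in the Euclidean condition for a fixed $\mathbf{L}$, "sufficiently small time steps" means for all $0<\tau\le\tau_0$ with some $\tau_0=\tau_0(\mathbf{L})>0$ independent of $u^0$. *)

theory Defs
  imports
    "Jordan_Normal_Form.Char_Poly"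
    "Jordan_Normal_Form.Matrix_Kernel"
    "Jordan_Normal_Form.Schur_Decomposition"
begin

text \<open>Stages are numbered \<open>1, \<dots>, s\<close>; only the entries \<open>a i j\<close> with \<open>1 \<le> j < i \<le> s\<close> and
  \<open>b i\<close> with \<open>1 \<le> i \<le> s\<close> are used. Linear combinations of vectors are written
  componentwise because the type \<open>complex vec\<close>, which contains vectors of all dimensions,
  is not an additive monoid.\<close>

function rk_stage ::
  "(nat \<Rightarrow> nat \<Rightarrow> complex) \<Rightarrow> complex mat \<Rightarrow> real \<Rightarrow> complex vec \<Rightarrow> nat \<Rightarrow> complex vec"
  where
  "rk_stage a L \<tau> u i =
     L *\<^sub>v (u + complex_of_real \<tau> \<cdot>\<^sub>v
            vec (dim_vec u) (\<lambda>r. \<Sum>j = 1..<i. a i j * rk_stage a L \<tau> u j $ r))"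
  by pat_completeness auto
termination by (relation "measure (\<lambda>(a, L, \<tau>, u, i). i)") auto

declare rk_stage.simps [simp del]

definition rk_step ::
  "nat \<Rightarrow> (nat \<Rightarrow> nat \<Rightarrow> complex) \<Rightarrow> (nat \<Rightarrow> complex) \<Rightarrow> complex mat \<Rightarrow> real \<Rightarrow> complex vec \<Rightarrow> complex vec"
  where
  "rk_step s a b L \<tau> u =
     u + complex_of_real \<tau> \<cdot>\<^sub>v
         vec (dim_vec u) (\<lambda>r. \<Sum>i = 1..s. b i * rk_stage a L \<tau> u i $ r)"


function rk_stage_poly :: "(nat \<Rightarrow> nat \<Rightarrow> complex) \<Rightarrow> nat \<Rightarrow> complex poly" where
  "rk_stage_poly a i = [:0, 1:] * (1 + (\<Sum>j = 1..<i. smult (a i j) (rk_stage_poly a j)))"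
  by pat_completeness auto
termination by (relation "measure (\<lambda>(a, i). i)") auto

declare rk_stage_poly.simps [simp del]

definition stability_function ::
  "nat \<Rightarrow> (nat \<Rightarrow> nat \<Rightarrow> complex) \<Rightarrow> (nat \<Rightarrow> complex) \<Rightarrow> complex poly" where
  "stability_function s a b = 1 + (\<Sum>i = 1..s. smult (b i) (rk_stage_poly a i))"

definition poly_mat :: "complex poly \<Rightarrow> complex mat \<Rightarrow> complex mat" where
  "poly_mat p A =
     mat (dim_row A) (dim_row A) (\<lambda>(r, c). \<Sum>k\<le>degree p. coeff p k * (A ^\<^sub>m k) $$ (r, c))"


definition hermitian :: "complex mat \<Rightarrow> bool" where
  "hermitian A \<longleftrightarrow> mat_adjoint A = A"

text \<open>\<open>(A *\<^sub>v x) \<bullet>c x\<close> is \<open>\<langle>x, A x\<rangle>\<close>, the second factor of \<open>\<bullet>c\<close> being conjugated;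
  it is real for Hermitian \<open>A\<close>.\<close>

definition positive_definite :: "complex mat \<Rightarrow> bool" where
  "positive_definite A \<longleftrightarrow> hermitian A \<and>
     (\<forall>x \<in> carrier_vec (dim_row A). x \<noteq> 0\<^sub>v (dim_row A) \<longrightarrow> 0 < Re ((A *\<^sub>v x) \<bullet>c x))"

definition negative_semidefinite :: "complex mat \<Rightarrow> bool" where
  "negative_semidefinite A \<longleftrightarrow> hermitian A \<and>
     (\<forall>x \<in> carrier_vec (dim_row A). Re ((A *\<^sub>v x) \<bullet>c x) \<le> 0)"

text \<open>Here \<open>char_matrix L \<mu>\<close> is \<open>L - \<mu> I\<close>, so that \<open>kernel_dim\<close> below yields the geometric
  multiplicity of \<open>\<mu>\<close>.\<close>

definition non_defective :: "complex mat \<Rightarrow> complex \<Rightarrow> bool" where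
  "non_defective L \<mu> \<longleftrightarrow> Polynomial.order \<mu> (char_poly L) = kernel_dim (char_matrix L \<mu>)"

definition lyapunov_stable :: "complex mat \<Rightarrow> bool" where
  "lyapunov_stable L \<longleftrightarrow>
     (\<forall>\<mu>. eigenvalue L \<mu> \<longrightarrow> Re \<mu> \<le> 0 \<and> (Re \<mu> = 0 \<longrightarrow> non_defective L \<mu>))"

definition asymptotically_stable :: "complex mat \<Rightarrow> bool" where
  "asymptotically_stable L \<longleftrightarrow> (\<forall>\<mu>. eigenvalue L \<mu> \<longrightarrow> Re \<mu> < 0)"

definition semi_dissipative :: "complex mat \<Rightarrow> bool" where
  "semi_dissipative L \<longleftrightarrow> negative_semidefinite ((1 / 2) \<cdot>\<^sub>m (L + mat_adjoint L))"

definition euclidean_norm :: "complex vec \<Rightarrow> real" where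
  "euclidean_norm u = sqrt (\<Sum>i<dim_vec u. (cmod (u $ i))\<^sup>2)"

definition weighted_norm :: "complex mat \<Rightarrow> complex vec \<Rightarrow> real" where
  "weighted_norm P u = sqrt (Re ((P *\<^sub>v u) \<bullet>c u))"


definition strongly_stable ::
  "nat \<Rightarrow> (nat \<Rightarrow> nat \<Rightarrow> complex) \<Rightarrow> (nat \<Rightarrow> complex) \<Rightarrow> bool" where
  "strongly_stable s a b \<longleftrightarrow>
     (\<forall>n. \<forall>L \<in> carrier_mat n n. \<forall>P \<in> carrier_mat n n.
        lyapunov_stable L \<and> positive_definite P \<and>
        negative_semidefinite (mat_adjoint L * P + P * L) \<longrightarrow>
        (\<exists>\<tau>\<^sub>0 > 0. \<forall>\<tau>. 0 < \<tau> \<and> \<tau> \<le> \<tau>\<^sub>0 \<longrightarrow>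
           (\<forall>u \<in> carrier_vec n. weighted_norm P (rk_step s a b L \<tau> u) \<le> weighted_norm P u)))"

definition strongly_stable_wrt ::
  "nat \<Rightarrow> (nat \<Rightarrow> nat \<Rightarrow> complex) \<Rightarrow> (nat \<Rightarrow> complex) \<Rightarrow> complex mat set \<Rightarrow> bool" where
  "strongly_stable_wrt s a b \<L> \<longleftrightarrow>
     (\<forall>L \<in> \<L>. \<exists>\<tau>\<^sub>0 > 0. \<forall>\<tau>. 0 < \<tau> \<and> \<tau> \<le> \<tau>\<^sub>0 \<longrightarrow>
        (\<forall>u \<in> carrier_vec (dim_row L).
           euclidean_norm (rk_step s a b L \<tau> u) \<le> euclidean_norm u))"

definition L_AS :: "complex mat set" where
  "L_AS = (\<Union>n. {L \<in> carrier_mat n n. asymptotically_stable L \<and> semi_dissipative L})"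

definition L_IM :: "complex mat set" where
  "L_IM = {L \<in> carrier_mat 1 1. Re (L $$ (0, 0)) = 0}"


lemma rk_stage_carrier:
  assumes "L \<in> carrier_mat n n"
  shows "rk_stage a L \<tau> u i \<in> carrier_vec n"
  using assms by (subst rk_stage.simps, intro carrier_vecI) auto

lemma poly_mat_carrier: "A \<in> carrier_mat n n \<Longrightarrow> poly_mat p A \<in> carrier_mat n n"
  by (simp add: poly_mat_def)

lemma poly_mat_index:
  assumes A: "A \<in> carrier_mat n n" and r: "r < n" "c < n" and d: "degree p \<le> d"
  shows "poly_mat p A $$ (r, c) = (\<Sum>k\<le>d. coeff p k * (A ^\<^sub>m k) $$ (r, c))"
proof -
  have "(\<Sum>k\<le>degree p. coeff p k * (A ^\<^sub>m k) $$ (r, c)) = (\<Sum>k\<le>d. coeff p k * (A ^\<^sub>m k) $$ (r, c))"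
    using d by (intro sum.mono_neutral_left) (auto simp: coeff_eq_0)
  then show ?thesis using A r by (auto simp: poly_mat_def)
qed

lemma poly_mat_1:
  assumes A: "A \<in> carrier_mat n n"
  shows "poly_mat 1 A = 1\<^sub>m n"
  using A by (intro eq_matI) (auto simp: poly_mat_def)

lemma poly_mat_add:
  assumes A: "A \<in> carrier_mat n n"
  shows "poly_mat (p + q) A = poly_mat p A + poly_mat q A"
proof (intro eq_matI)
  fix r c assume "r < dim_row (poly_mat p A + poly_mat q A)" "c < dim_col (poly_mat p A + poly_mat q A)"
  with A have r: "r < n" "c < n" by (auto simp: poly_mat_def)
  define d where "d = max (degree p) (degree q)"
  have d: "degree (p + q) \<le> d" "degree p \<le> d" "degree q \<le> d"
    by (auto simp: d_def degree_add_le_max)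
  show "poly_mat (p + q) A $$ (r, c) = (poly_mat p A + poly_mat q A) $$ (r, c)"
    using poly_mat_carrier[OF A, of q] poly_mat_index[OF A r d(1)] poly_mat_index[OF A r d(2)]
      poly_mat_index[OF A r d(3)] r
    by (simp add: algebra_simps sum.distrib)
qed (use A in \<open>auto simp: poly_mat_def\<close>)

lemma poly_mat_smult:
  assumes A: "A \<in> carrier_mat n n"
  shows "poly_mat (smult c p) A = c \<cdot>\<^sub>m poly_mat p A"
proof (intro eq_matI)
  fix i j assume "i < dim_row (c \<cdot>\<^sub>m poly_mat p A)" "j < dim_col (c \<cdot>\<^sub>m poly_mat p A)"
  with A have r: "i < n" "j < n" by (auto simp: poly_mat_def)
  show "poly_mat (smult c p) A $$ (i, j) = (c \<cdot>\<^sub>m poly_mat p A) $$ (i, j)"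
    using poly_mat_carrier[OF A, of p] poly_mat_index[OF A r degree_smult_le]
      poly_mat_index[OF A r order.refl] r
    by (simp add: algebra_simps sum_distrib_left)
qed (use A in \<open>auto simp: poly_mat_def\<close>)

lemma poly_mat_X_mult:
  assumes A: "A \<in> carrier_mat n n"
  shows "poly_mat ([:0, 1:] * p) A = A * poly_mat p A"
proof (intro eq_matI)
  fix i j assume "i < dim_row (A * poly_mat p A)" "j < dim_col (A * poly_mat p A)"
  with A have r: "i < n" "j < n" by (auto simp: poly_mat_def)
  have d: "degree ([:0, 1:] * p) \<le> Suc (degree p)"
    using degree_mult_le[of "[:0, 1:]" p] by simp
  have pow: "(A ^\<^sub>m Suc k) $$ (i, j) = (\<Sum>l<n. A $$ (i, l) * (A ^\<^sub>m k) $$ (l, j))" for k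
  proof -
    have "A ^\<^sub>m Suc k = A * A ^\<^sub>m k"
    proof (induction k)
      case (Suc k)
      have "A ^\<^sub>m Suc (Suc k) = (A * A ^\<^sub>m k) * A" using Suc by simp
      also have "\<dots> = A * (A ^\<^sub>m k * A)" using A by (intro assoc_mult_mat) auto
      finally show ?case by simp
    qed (use A in auto)
    then show ?thesis using A r by (simp add: scalar_prod_def atLeast0LessThan)
  qed
  have "poly_mat ([:0, 1:] * p) A $$ (i, j) = (\<Sum>k\<le>degree p. coeff p k * (A ^\<^sub>m Suc k) $$ (i, j))"
    unfolding poly_mat_index[OF A r d] by (subst sum.atMost_Suc_shift) simp
  also have "\<dots> = (\<Sum>l<n. A $$ (i, l) * (\<Sum>k\<le>degree p. coeff p k * (A ^\<^sub>m k) $$ (l, j)))"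
    unfolding pow sum_distrib_left by (subst sum.swap) (simp add: algebra_simps)
  also have "\<dots> = (\<Sum>l<n. A $$ (i, l) * poly_mat p A $$ (l, j))"
    using poly_mat_index[OF A _ r(2) order.refl] by (intro sum.cong) auto
  also have "\<dots> = (A * poly_mat p A) $$ (i, j)"
    using A r poly_mat_carrier[OF A, of p] by (simp add: scalar_prod_def atLeast0LessThan)
  finally show "poly_mat ([:0, 1:] * p) A $$ (i, j) = (A * poly_mat p A) $$ (i, j)" .
qed (use A in \<open>auto simp: poly_mat_def\<close>)

lemma poly_mat_affine_mult_vec:
  assumes A: "A \<in> carrier_mat n n" and u: "u \<in> carrier_vec n" and J: "finite J"
  shows "poly_mat (1 + (\<Sum>j\<in>J. smult (c j) (q j))) A *\<^sub>v u
       = u + vec n (\<lambda>r. \<Sum>j\<in>J. c j * (poly_mat (q j) A *\<^sub>v u) $ r)"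
  using J
proof induction
  case empty
  then show ?case using A u by (auto simp: poly_mat_1)
next
  case (insert x F)
  let ?p = "1 + (\<Sum>j\<in>F. smult (c j) (q j))"
  have C: "poly_mat p A \<in> carrier_mat n n" for p using A by (rule poly_mat_carrier)
  have "poly_mat (1 + (\<Sum>j\<in>insert x F. smult (c j) (q j))) A *\<^sub>v u
      = poly_mat (?p + smult (c x) (q x)) A *\<^sub>v u"
    using insert by (simp add: ac_simps)
  also have "\<dots> = poly_mat ?p A *\<^sub>v u + c x \<cdot>\<^sub>v (poly_mat (q x) A *\<^sub>v u)"
    unfolding poly_mat_add[OF A] poly_mat_smult[OF A]
    using C u by (subst add_mult_distrib_mat_vec[of _ n n]) (auto intro!: eq_vecI simp: C[THEN carrier_matD(1)] C[THEN carrier_matD(2)])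
  also have "\<dots> = u + vec n (\<lambda>r. \<Sum>j\<in>insert x F. c j * (poly_mat (q j) A *\<^sub>v u) $ r)"
    unfolding insert.IH using insert.hyps C[of "q x"] u by (intro eq_vecI) auto
  finally show ?case .
qed

lemma rk_stage_eq_poly_mat:
  assumes L: "L \<in> carrier_mat n n" and u: "u \<in> carrier_vec n"
  shows "complex_of_real \<tau> \<cdot>\<^sub>v rk_stage a L \<tau> u i
       = poly_mat (rk_stage_poly a i) (complex_of_real \<tau> \<cdot>\<^sub>m L) *\<^sub>v u"
proof (induction i rule: less_induct)
  case (less i)
  let ?A = "complex_of_real \<tau> \<cdot>\<^sub>m L"
  let ?p = "1 + (\<Sum>j = 1..<i. smult (a i j) (rk_stage_poly a j))"
  have A: "?A \<in> carrier_mat n n" using L by simp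
  have step: "complex_of_real \<tau> \<cdot>\<^sub>v vec (dim_vec u) (\<lambda>r. \<Sum>j = 1..<i. a i j * rk_stage a L \<tau> u j $ r)
      = vec n (\<lambda>r. \<Sum>j = 1..<i. a i j * (poly_mat (rk_stage_poly a j) ?A *\<^sub>v u) $ r)"
  proof (intro eq_vecI)
    fix r assume "r < dim_vec (vec n (\<lambda>r. \<Sum>j = 1..<i. a i j * (poly_mat (rk_stage_poly a j) ?A *\<^sub>v u) $ r))"
    then have r: "r < n" by simp
    have "a i j * (poly_mat (rk_stage_poly a j) ?A *\<^sub>v u) $ r
        = complex_of_real \<tau> * (a i j * rk_stage a L \<tau> u j $ r)" if "j \<in> {1..<i}" for j
      using less.IH[of j, symmetric] that r rk_stage_carrier[OF L, of a \<tau> u j] by simp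
    then have "(\<Sum>j = 1..<i. a i j * (poly_mat (rk_stage_poly a j) ?A *\<^sub>v u) $ r)
        = complex_of_real \<tau> * (\<Sum>j = 1..<i. a i j * rk_stage a L \<tau> u j $ r)"
      unfolding sum_distrib_left by (intro sum.cong) simp_all
    then show "(complex_of_real \<tau> \<cdot>\<^sub>v vec (dim_vec u) (\<lambda>r. \<Sum>j = 1..<i. a i j * rk_stage a L \<tau> u j $ r)) $ r
      = vec n (\<lambda>r. \<Sum>j = 1..<i. a i j * (poly_mat (rk_stage_poly a j) ?A *\<^sub>v u) $ r) $ r"
      using r u by simp
  qed (use u in auto)
  have "poly_mat (rk_stage_poly a i) ?A *\<^sub>v u = ?A *\<^sub>v (poly_mat ?p ?A *\<^sub>v u)"
    by (subst rk_stage_poly.simps, subst poly_mat_X_mult[OF A],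
        rule assoc_mult_mat_vec[OF A poly_mat_carrier[OF A] u])
  also have "\<dots> = complex_of_real \<tau> \<cdot>\<^sub>v (L *\<^sub>v (poly_mat ?p ?A *\<^sub>v u))"
    using L by (intro eq_vecI) (auto simp: poly_mat_def)
  also have "\<dots> = complex_of_real \<tau> \<cdot>\<^sub>v rk_stage a L \<tau> u i"
    using step poly_mat_affine_mult_vec[OF A u, of "{1..<i}"] rk_stage.simps[of a L \<tau> u i] by simp
  finally show ?case by simp
qed

theorem rk_step_eq_stability_function:
  assumes L: "L \<in> carrier_mat n n" and u: "u \<in> carrier_vec n"
  shows "rk_step s a b L \<tau> u = poly_mat (stability_function s a b) (complex_of_real \<tau> \<cdot>\<^sub>m L) *\<^sub>v u"
proof -
  let ?A = "complex_of_real \<tau> \<cdot>\<^sub>m L"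
  have A: "?A \<in> carrier_mat n n" using L by simp
  have "poly_mat (stability_function s a b) ?A *\<^sub>v u
      = u + vec n (\<lambda>r. \<Sum>i = 1..s. b i * (complex_of_real \<tau> \<cdot>\<^sub>v rk_stage a L \<tau> u i) $ r)"
    unfolding stability_function_def rk_stage_eq_poly_mat[OF L u]
    by (rule poly_mat_affine_mult_vec[OF A u]) simp
  also have "\<dots> = rk_step s a b L \<tau> u"
  proof (intro eq_vecI)
    fix r assume "r < dim_vec (rk_step s a b L \<tau> u)"
    then have r: "r < n" using u by (simp add: rk_step_def)
    have "b i * (complex_of_real \<tau> \<cdot>\<^sub>v rk_stage a L \<tau> u i) $ r
        = complex_of_real \<tau> * (b i * rk_stage a L \<tau> u i $ r)" for i
      using r rk_stage_carrier[OF L, of a \<tau> u i] by simp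
    then have "(\<Sum>i = 1..s. b i * (complex_of_real \<tau> \<cdot>\<^sub>v rk_stage a L \<tau> u i) $ r)
        = complex_of_real \<tau> * (\<Sum>i = 1..s. b i * rk_stage a L \<tau> u i $ r)"
      unfolding sum_distrib_left by (intro sum.cong) simp_all
    then show "(u + vec n (\<lambda>r. \<Sum>i = 1..s. b i * (complex_of_real \<tau> \<cdot>\<^sub>v rk_stage a L \<tau> u i) $ r)) $ r
        = rk_step s a b L \<tau> u $ r"
      using r u by (simp add: rk_step_def)
  qed (use u in \<open>auto simp: rk_step_def\<close>)
  finally show ?thesis by simp
qed

end

theory Submission
  imports Defs
begin

text \<open>A frame \<open>S\<close> with \<open>S\<^sup>* P S = I\<close> turns \<open>L\<close> into a semi-dissipative matrix \<open>S\<^sup>-\<^sup>1 L S\<close> and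
  \<open>\<parallel>\<cdot>\<parallel>\<^sub>P\<close> into the Euclidean norm. An eigenvector \<open>v\<close> of a semi-dissipative matrix for an imaginary
  eigenvalue is orthogonal to the image of \<open>v\<^sup>\<bottom>\<close>, so a unitary change of basis splits off the
  eigenvalue as a one-dimensional diagonal block. Inductively, the matrix becomes the orthogonal
  sum of imaginary scalars and an asymptotically stable semi-dissipative matrix, and the smallest
  of the time steps of these finitely many blocks works for the whole matrix.\<close>

section \<open>Adjoints and quadratic forms\<close>

lemma mat_adjoint_dim [simp]:
  "dim_row (mat_adjoint A) = dim_col A" "dim_col (mat_adjoint A) = dim_row A"
  by (simp_all add: mat_adjoint_def)

lemma mat_adjoint_carrier [simp]:
  "A \<in> carrier_mat n m \<Longrightarrow> mat_adjoint A \<in> carrier_mat m n"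
  by auto

lemma mat_adjoint_index [simp]:
  fixes A :: "complex mat"
  assumes "i < dim_col A" "j < dim_row A"
  shows "mat_adjoint A $$ (i, j) = cnj (A $$ (j, i))"
  using assms by (simp add: mat_adjoint_def mat_of_rows_index)

lemma mat_adjoint_one: "mat_adjoint (1\<^sub>m n :: complex mat) = 1\<^sub>m n"
  by (intro eq_matI) auto

lemma cscalar_prod_sum:
  fixes x y :: "complex vec"
  assumes "y \<in> carrier_vec n"
  shows "x \<bullet>c y = (\<Sum>i<n. x $ i * cnj (y $ i))"
  using assms by (simp add: scalar_prod_def atLeast0LessThan)

lemma cscalar_prod_mat_adjoint:
  fixes A :: "complex mat"
  assumes A: "A \<in> carrier_mat n m" and x: "x \<in> carrier_vec m" and y: "y \<in> carrier_vec n"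
  shows "(A *\<^sub>v x) \<bullet>c y = x \<bullet>c (mat_adjoint A *\<^sub>v y)"
proof -
  have "(A *\<^sub>v x) \<bullet>c y = (\<Sum>i<n. (\<Sum>j<m. A $$ (i, j) * x $ j) * cnj (y $ i))"
    unfolding cscalar_prod_sum[OF y]
    using A x by (intro sum.cong) (auto simp: scalar_prod_def atLeast0LessThan)
  also have "\<dots> = (\<Sum>j<m. x $ j * cnj (\<Sum>i<n. cnj (A $$ (i, j)) * y $ i))"
    unfolding sum_distrib_left sum_distrib_right cnj_sum
    by (subst sum.swap) (simp add: ac_simps)
  also have "\<dots> = (\<Sum>j<m. x $ j * cnj ((mat_adjoint A *\<^sub>v y) $ j))"
    using A y by (intro sum.cong) (auto simp: scalar_prod_def atLeast0LessThan)
  also have "\<dots> = x \<bullet>c (mat_adjoint A *\<^sub>v y)"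
    using A y by (intro cscalar_prod_sum[symmetric]) (auto intro!: mult_mat_vec_carrier)
  finally show ?thesis .
qed

lemma cscalar_prod_commute:
  fixes x y :: "complex vec"
  assumes "x \<in> carrier_vec n" "y \<in> carrier_vec n"
  shows "y \<bullet>c x = cnj (x \<bullet>c y)"
  unfolding cscalar_prod_sum[OF assms(1)] cscalar_prod_sum[OF assms(2)] by (simp add: ac_simps)

lemma cscalar_prod_add_left:
  fixes x y z :: "complex vec"
  assumes "x \<in> carrier_vec n" "y \<in> carrier_vec n" "z \<in> carrier_vec n"
  shows "(x + y) \<bullet>c z = x \<bullet>c z + y \<bullet>c z"
  using assms by (simp add: add_scalar_prod_distrib[of _ n])

lemma cscalar_prod_add_right:
  fixes x y z :: "complex vec"
  assumes "x \<in> carrier_vec n" "y \<in> carrier_vec n" "z \<in> carrier_vec n"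
  shows "z \<bullet>c (x + y) = z \<bullet>c x + z \<bullet>c y"
  using assms by (simp add: conjugate_add_vec[of _ n] scalar_prod_add_distrib[of _ n])

lemma cscalar_prod_smult_left:
  fixes x y :: "complex vec"
  assumes "x \<in> carrier_vec n" "y \<in> carrier_vec n"
  shows "(c \<cdot>\<^sub>v x) \<bullet>c y = c * (x \<bullet>c y)"
  using assms by (simp add: smult_scalar_prod_distrib[of _ n])

lemma cscalar_prod_smult_right:
  fixes x y :: "complex vec"
  assumes "x \<in> carrier_vec n" "y \<in> carrier_vec n"
  shows "y \<bullet>c (c \<cdot>\<^sub>v x) = cnj c * (y \<bullet>c x)"
  using assms by (simp add: cscalar_prod_sum[of _ n] sum_distrib_left ac_simps)

lemmas cscalar_prod_linear = cscalar_prod_add_left cscalar_prod_add_right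
  cscalar_prod_smult_left cscalar_prod_smult_right

lemma mult_mat_vec_smult:
  fixes A :: "complex mat"
  assumes "A \<in> carrier_mat n m" "x \<in> carrier_vec m"
  shows "A *\<^sub>v (c \<cdot>\<^sub>v x) = c \<cdot>\<^sub>v (A *\<^sub>v x)"
  using assms by (intro eq_vecI) auto

lemma mult_mat_unit_vec:
  fixes A :: "complex mat"
  assumes "A \<in> carrier_mat n m" "j < m"
  shows "A *\<^sub>v unit_vec m j = col A j"
  using assms by (intro eq_vecI) auto

lemma Re_cscalar_prod_self:
  fixes x :: "complex vec"
  assumes "x \<in> carrier_vec n"
  shows "Re (x \<bullet>c x) = (\<Sum>i<n. (cmod (x $ i))\<^sup>2)"
  unfolding cscalar_prod_sum[OF assms] Re_sum
  by (intro sum.cong) (simp_all only: cmod_power2, simp_all add: power2_eq_square)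

lemma Re_cscalar_prod_self_pos:
  fixes x :: "complex vec"
  assumes x: "x \<in> carrier_vec n" and "x \<noteq> 0\<^sub>v n"
  shows "0 < Re (x \<bullet>c x)"
proof -
  obtain i where "i < n" "x $ i \<noteq> 0"
    using assms by (metis eq_vecI carrier_vecD index_zero_vec)
  then show ?thesis
    unfolding Re_cscalar_prod_self[OF x] by (intro sum_pos2[of _ i]) auto
qed

lemma weighted_norm_one:
  assumes "x \<in> carrier_vec n"
  shows "weighted_norm (1\<^sub>m n) x = euclidean_norm x"
  using assms Re_cscalar_prod_self[OF assms] by (simp add: weighted_norm_def euclidean_norm_def)

lemma positive_definite_one: "positive_definite (1\<^sub>m n)"
  by (auto simp: positive_definite_def hermitian_def mat_adjoint_one Re_cscalar_prod_self_pos)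

lemma hermitian_cscalar_prod:
  assumes "P \<in> carrier_mat n n" "hermitian P" "x \<in> carrier_vec n" "y \<in> carrier_vec n"
  shows "(P *\<^sub>v x) \<bullet>c y = x \<bullet>c (P *\<^sub>v y)"
  using cscalar_prod_mat_adjoint[OF assms(1,3,4)] assms(2) by (simp add: hermitian_def)

text \<open>The forms of \<open>mat_adjoint L * P\<close> and \<open>P * L\<close> at
  \<open>x\<close> are complex conjugates of each other because \<open>P\<close> is Hermitian, so
  their sum is twice a real part.\<close>

lemma Re_lyapunov_form:
  assumes L: "L \<in> carrier_mat n n" and P: "P \<in> carrier_mat n n" "hermitian P"
    and x: "x \<in> carrier_vec n"
  shows "Re (((mat_adjoint L * P + P * L) *\<^sub>v x) \<bullet>c x) = 2 * Re ((P *\<^sub>v (L *\<^sub>v x)) \<bullet>c x)"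
proof -
  have La: "mat_adjoint L \<in> carrier_mat n n" using L by simp
  have Lx: "L *\<^sub>v x \<in> carrier_vec n" and Px: "P *\<^sub>v x \<in> carrier_vec n"
    using L P x by (auto intro: mult_mat_vec_carrier)
  have LPx: "mat_adjoint L *\<^sub>v (P *\<^sub>v x) \<in> carrier_vec n"
    and PLx: "P *\<^sub>v (L *\<^sub>v x) \<in> carrier_vec n"
    using La P Lx Px by (auto intro: mult_mat_vec_carrier)
  have "(mat_adjoint L *\<^sub>v (P *\<^sub>v x)) \<bullet>c x = cnj ((L *\<^sub>v x) \<bullet>c (P *\<^sub>v x))"
    using cscalar_prod_mat_adjoint[OF L x Px] cscalar_prod_commute[OF x LPx] by simp
  moreover have "(P *\<^sub>v (L *\<^sub>v x)) \<bullet>c x = (L *\<^sub>v x) \<bullet>c (P *\<^sub>v x)"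
    by (rule hermitian_cscalar_prod[OF P Lx x])
  moreover have "(mat_adjoint L * P + P * L) *\<^sub>v x
      = mat_adjoint L *\<^sub>v (P *\<^sub>v x) + P *\<^sub>v (L *\<^sub>v x)"
    using La L P x
    by (subst add_mult_distrib_mat_vec[of _ n n]) (auto simp: assoc_mult_mat_vec[of _ n n _ n])
  ultimately show ?thesis
    using cscalar_prod_add_left[OF LPx PLx x] by simp
qed

text \<open>Taking adjoints swaps the two summands. The check is entrywise, with \<open>sym\<close>
  expressing that \<open>P\<close> is Hermitian.\<close>

lemma hermitian_lyapunov:
  assumes L: "L \<in> carrier_mat n n" and P: "P \<in> carrier_mat n n" "hermitian P"
  shows "hermitian (mat_adjoint L * P + P * L)"
proof -
  have sym: "cnj (P $$ (i, j)) = P $$ (j, i)" if "i < n" "j < n" for i j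
    using that P mat_adjoint_index[of j P i] unfolding hermitian_def by auto
  have "(\<Sum>k<n. cnj (cnj (L $$ (k, j)) * P $$ (k, i))) + (\<Sum>k<n. cnj (P $$ (j, k) * L $$ (k, i)))
     = (\<Sum>k<n. cnj (L $$ (k, i)) * P $$ (k, j)) + (\<Sum>k<n. P $$ (i, k) * L $$ (k, j))"
    if "i < n" "j < n" for i j
    using that sym by (subst add.commute) (intro arg_cong2[of _ _ _ _ plus] sum.cong; simp)
  then show ?thesis
    unfolding hermitian_def using L P
    by (intro eq_matI) (simp_all add: scalar_prod_def atLeast0LessThan)
qed

lemma negative_semidefinite_lyapunov_iff:
  assumes L: "L \<in> carrier_mat n n" and P: "P \<in> carrier_mat n n" "hermitian P"
  shows "negative_semidefinite (mat_adjoint L * P + P * L) \<longleftrightarrow>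
     (\<forall>x \<in> carrier_vec n. Re ((P *\<^sub>v (L *\<^sub>v x)) \<bullet>c x) \<le> 0)"
  using hermitian_lyapunov[OF assms] Re_lyapunov_form[OF assms] P L
  by (simp add: negative_semidefinite_def)

text \<open>Serves to absorb the factor 1/2 of the Hermitian part in
  \<open>semi_dissipative\<close>.\<close>

lemma negative_semidefinite_smult_iff:
  assumes "A \<in> carrier_mat n n" "0 < c"
  shows "negative_semidefinite (complex_of_real c \<cdot>\<^sub>m A) \<longleftrightarrow> negative_semidefinite A"
proof -
  have "hermitian (complex_of_real c \<cdot>\<^sub>m A) \<longleftrightarrow> hermitian A"
    using assms by (auto simp: hermitian_def mat_eq_iff)
  moreover have "((complex_of_real c \<cdot>\<^sub>m A) *\<^sub>v x) \<bullet>c x = complex_of_real c * ((A *\<^sub>v x) \<bullet>c x)"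
    if "x \<in> carrier_vec n" for x
  proof -
    have "(complex_of_real c \<cdot>\<^sub>m A) *\<^sub>v x = complex_of_real c \<cdot>\<^sub>v (A *\<^sub>v x)"
      using assms that by (intro eq_vecI) auto
    then show ?thesis
      using cscalar_prod_smult_left[OF mult_mat_vec_carrier[OF assms(1) that] that] by simp
  qed
  ultimately show ?thesis
    using assms by (simp add: negative_semidefinite_def mult_le_0_iff)
qed

text \<open>The matrix \<open>L + mat_adjoint L\<close> is the Lyapunov expression for
  \<open>P = I\<close>, so the criterion for general \<open>P\<close> applies.\<close>

lemma semi_dissipative_iff:
  assumes L: "L \<in> carrier_mat n n"
  shows "semi_dissipative L \<longleftrightarrow> (\<forall>x \<in> carrier_vec n. Re ((L *\<^sub>v x) \<bullet>c x) \<le> 0)"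
proof -
  have "L + mat_adjoint L = mat_adjoint L * 1\<^sub>m n + 1\<^sub>m n * L"
    using L by (simp add: comm_add_mat[of _ n n])
  moreover have "hermitian (1\<^sub>m n)" by (simp add: hermitian_def mat_adjoint_one)
  moreover have "1\<^sub>m n *\<^sub>v (L *\<^sub>v x) = L *\<^sub>v x" if "x \<in> carrier_vec n" for x
    using that L by (intro one_mult_mat_vec) (auto intro: mult_mat_vec_carrier)
  ultimately show ?thesis
    unfolding semi_dissipative_def
    using negative_semidefinite_smult_iff[of "L + mat_adjoint L" n "1/2"]
      negative_semidefinite_lyapunov_iff[of L n "1\<^sub>m n"] L by simp
qed

section \<open>Orthonormal frames\<close>

text \<open>The fewer than \<open>n\<close> conditions are the first rows of a square matrix padded
  with zero rows. It is singular, and a nonzero kernel vector solves all of them.\<close>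

lemma exists_nonzero_orthogonal:
  fixes w :: "nat \<Rightarrow> complex vec"
  assumes w: "\<And>i. i < k \<Longrightarrow> w i \<in> carrier_vec n" and k: "k < n"
  shows "\<exists>x \<in> carrier_vec n. x \<noteq> 0\<^sub>v n \<and> (\<forall>i<k. x \<bullet>c w i = 0)"
proof -
  define A where "A = mat n n (\<lambda>(i, j). if i < k then cnj (w i $ j) else 0)"
  have A: "A \<in> carrier_mat n n" by (simp add: A_def)
  \<comment> \<open>Row \<open>k\<close> of \<open>A\<close> is the first padding row, so column
    \<open>k\<close> of the transpose vanishes.\<close>
  have "transpose_mat A *\<^sub>v unit_vec n k = 0\<^sub>v n"
    using k by (intro eq_vecI) (auto simp: A_def scalar_prod_right_unit)
  moreover have "unit_vec n k \<noteq> (0\<^sub>v n :: complex vec)" using k by simp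
  ultimately have "det (transpose_mat A) = 0"
    using A by (subst det_0_iff_vec_prod_zero_field[of _ n]) (auto intro: exI[of _ "unit_vec n k"])
  then have "det A = 0" using det_transpose[OF A] by simp
  then obtain x where x: "x \<in> carrier_vec n" "x \<noteq> 0\<^sub>v n" "A *\<^sub>v x = 0\<^sub>v n"
    using det_0_iff_vec_prod_zero_field[OF A] by auto
  have "x \<bullet>c w i = 0" if i: "i < k" for i
  proof -
    have "x \<bullet>c w i = (A *\<^sub>v x) $ i"
      using i k w[OF i] x(1)
      by (auto simp: A_def cscalar_prod_sum scalar_prod_def atLeast0LessThan intro!: sum.cong)
    then show ?thesis using x(3) i k by simp
  qed
  then show ?thesis using x by blast
qed

text \<open>Orthonormality for the inner product given by \<open>P\<close>. A family is a function
  of which the first \<open>k\<close> values count, so it can be enlarged by a function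
  update.\<close>

definition orthonormal_wrt :: "complex mat \<Rightarrow> nat \<Rightarrow> (nat \<Rightarrow> complex vec) \<Rightarrow> bool" where
  "orthonormal_wrt P k e \<longleftrightarrow> (\<forall>i<k. e i \<in> carrier_vec (dim_row P) \<and>
     (\<forall>j<k. (P *\<^sub>v e j) \<bullet>c e i = (if i = j then 1 else 0)))"

text \<open>The form is real at \<open>x\<close> because \<open>P\<close> is Hermitian, and positive
  because \<open>x\<close> is nonzero; dividing \<open>x\<close> by its square root normalizes
  it.\<close>

lemma normalize_wrt:
  assumes P: "P \<in> carrier_mat n n" "positive_definite P"
    and x: "x \<in> carrier_vec n" "x \<noteq> 0\<^sub>v n"
  shows "\<exists>c. (P *\<^sub>v (c \<cdot>\<^sub>v x)) \<bullet>c (c \<cdot>\<^sub>v x) = 1"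
proof -
  let ?q = "(P *\<^sub>v x) \<bullet>c x"
  have Px: "P *\<^sub>v x \<in> carrier_vec n" using P x by (auto intro: mult_mat_vec_carrier)
  have H: "hermitian P" and pos: "0 < Re ?q" using P x by (auto simp: positive_definite_def)
  have "?q = cnj ?q"
    using hermitian_cscalar_prod[OF P(1) H x(1) x(1)] cscalar_prod_commute[OF x(1) Px] by simp
  then have q: "?q = complex_of_real (Re ?q)" by (metis Reals_cnj_iff of_real_Re)
  define c where "c = complex_of_real (1 / sqrt (Re ?q))"
  have "(P *\<^sub>v (c \<cdot>\<^sub>v x)) \<bullet>c (c \<cdot>\<^sub>v x) = c * (cnj c * ?q)"
    using mult_mat_vec_smult[OF P(1) x(1)] Px x by (simp add: cscalar_prod_linear[of _ n])
  also have "\<dots> = complex_of_real (1 / sqrt (Re ?q) * (1 / sqrt (Re ?q) * Re ?q))"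
    unfolding of_real_mult q[symmetric] by (simp add: c_def)
  also have "\<dots> = 1" using pos by simp
  finally show ?thesis by blast
qed

text \<open>As long as fewer than \<open>n\<close> vectors are present, a nonzero vector orthogonal
  to all of them exists and can be normalized and appended. The induction descends from
  \<open>k = n\<close>.\<close>

lemma orthonormal_wrt_extend:
  assumes P: "P \<in> carrier_mat n n" "positive_definite P"
    and "k \<le> n" "orthonormal_wrt P k e"
  shows "\<exists>f. (\<forall>i<k. f i = e i) \<and> orthonormal_wrt P n f"
  using assms(3,4)
proof (induction k arbitrary: e rule: inc_induct)
  case base
  then show ?case by blast
next
  case (step k)
  have H: "hermitian P" using P by (simp add: positive_definite_def)
  have e: "e i \<in> carrier_vec n" if "i < k" for i
    using step.prems that P by (auto simp: orthonormal_wrt_def)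
  have Pe: "P *\<^sub>v e i \<in> carrier_vec n" if "i < k" for i
    using e[OF that] P by (auto intro: mult_mat_vec_carrier)
  \<comment> \<open>Euclidean orthogonality to the vectors \<open>P *\<^sub>v e i\<close> is
    orthogonality to the \<open>e i\<close> in the inner product of \<open>P\<close>.\<close>
  obtain x where x: "x \<in> carrier_vec n" "x \<noteq> 0\<^sub>v n" "\<And>i. i < k \<Longrightarrow> x \<bullet>c (P *\<^sub>v e i) = 0"
    using exists_nonzero_orthogonal[of k "\<lambda>i. P *\<^sub>v e i" n] Pe step.hyps by auto
  obtain c where c: "(P *\<^sub>v (c \<cdot>\<^sub>v x)) \<bullet>c (c \<cdot>\<^sub>v x) = 1"
    using normalize_wrt[OF P x(1,2)] by blast
  define y where "y = c \<cdot>\<^sub>v x"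
  have y: "y \<in> carrier_vec n" using x by (simp add: y_def)
  have ye: "y \<bullet>c (P *\<^sub>v e i) = 0" if "i < k" for i
    using x(1) x(3)[OF that] Pe[OF that] by (simp add: y_def cscalar_prod_linear[of _ n])
  have 1: "(P *\<^sub>v y) \<bullet>c e i = 0" if "i < k" for i
    using hermitian_cscalar_prod[OF P(1) H y e[OF that]] ye[OF that] by simp
  have 2: "(P *\<^sub>v e i) \<bullet>c y = 0" if "i < k" for i
    using cscalar_prod_commute[OF y Pe[OF that]] ye[OF that] by simp
  have "orthonormal_wrt P (Suc k) (e(k := y))"
    using step.prems 1 2 c y P by (auto simp: orthonormal_wrt_def less_Suc_eq y_def[symmetric])
  from step.IH[OF this] obtain f where "\<forall>i<Suc k. f i = (e(k := y)) i" "orthonormal_wrt P n f"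
    by blast
  then show ?case by (intro exI[of _ f]) auto
qed

text \<open>With the family as columns of \<open>S\<close>, the product
  \<open>mat_adjoint S * (P * S)\<close> is its Gram matrix in the inner product of
  \<open>P\<close>.\<close>

lemma orthonormal_wrt_mat:
  assumes P: "P \<in> carrier_mat n n" and f: "orthonormal_wrt P n f"
  defines "S \<equiv> mat_of_cols n (map f [0..<n])"
  shows "S \<in> carrier_mat n n" "mat_adjoint S * (P * S) = 1\<^sub>m n"
    "\<And>i. i < n \<Longrightarrow> col S i = f i"
proof -
  have fc: "f i \<in> carrier_vec n" if "i < n" for i
    using f P that by (auto simp: orthonormal_wrt_def)
  show S: "S \<in> carrier_mat n n" by (simp add: S_def mat_of_cols_def)
  show col: "col S i = f i" if "i < n" for i
    using that fc by (simp add: S_def col_mat_of_cols)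
  show "mat_adjoint S * (P * S) = 1\<^sub>m n"
  proof (intro eq_matI)
    fix i j assume "i < dim_row (1\<^sub>m n :: complex mat)" "j < dim_col (1\<^sub>m n :: complex mat)"
    then have ij: "i < n" "j < n" by auto
    have "row (mat_adjoint S) i = conjugate (f i)"
      using S ij col[OF ij(1)] fc[OF ij(1)] by (intro eq_vecI) (auto simp flip: col[OF ij(1)])
    moreover have Pc: "col (P * S) j = P *\<^sub>v f j"
      using col[OF ij(2)] col_mult2[OF P S ij(2)] by simp
    ultimately have "(mat_adjoint S * (P * S)) $$ (i, j) = conjugate (f i) \<bullet> (P *\<^sub>v f j)"
      using S P ij by simp
    also have "\<dots> = (P *\<^sub>v f j) \<bullet>c f i"
      using fc ij P by (intro comm_scalar_prod[of _ n]) (auto intro: mult_mat_vec_carrier)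
    also have "\<dots> = (1\<^sub>m n) $$ (i, j)"
      using f ij by (auto simp: orthonormal_wrt_def)
    finally show "(mat_adjoint S * (P * S)) $$ (i, j) = (1\<^sub>m n) $$ (i, j)" .
  qed (use S in auto)
qed

lemma exists_orthonormal_frame:
  assumes P: "P \<in> carrier_mat n n" "positive_definite P"
  shows "\<exists>S \<in> carrier_mat n n. mat_adjoint S * (P * S) = 1\<^sub>m n"
proof -
  have "orthonormal_wrt P 0 e" for e by (simp add: orthonormal_wrt_def)
  from orthonormal_wrt_extend[OF P _ this] obtain f where "orthonormal_wrt P n f" by auto
  then show ?thesis using orthonormal_wrt_mat(1,2)[OF P(1)] by blast
qed

text \<open>The normalized \<open>v\<close> is an orthonormal family of length one for
  \<open>P = I\<close>; it is extended to a full basis.\<close>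

lemma exists_unitary_with_first_col:
  fixes v :: "complex vec"
  assumes v: "v \<in> carrier_vec n" "v \<noteq> 0\<^sub>v n"
  shows "\<exists>S \<in> carrier_mat n n. \<exists>c. mat_adjoint S * S = 1\<^sub>m n \<and> col S 0 = c \<cdot>\<^sub>v v"
proof -
  have n: "0 < n" using v by (cases n) auto
  have P: "1\<^sub>m n \<in> carrier_mat n n" "positive_definite (1\<^sub>m n)"
    by (simp_all add: positive_definite_one)
  obtain c where c: "(1\<^sub>m n *\<^sub>v (c \<cdot>\<^sub>v v)) \<bullet>c (c \<cdot>\<^sub>v v) = 1"
    using normalize_wrt[OF P v] by blast
  have "orthonormal_wrt (1\<^sub>m n) 1 (\<lambda>_. c \<cdot>\<^sub>v v)"
    using v c by (simp add: orthonormal_wrt_def)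
  from orthonormal_wrt_extend[OF P _ this] n obtain f
    where f: "f 0 = c \<cdot>\<^sub>v v" "orthonormal_wrt (1\<^sub>m n) n f" by auto
  define S where "S = mat_of_cols n (map f [0..<n])"
  note S = orthonormal_wrt_mat[OF P(1) f(2), folded S_def]
  show ?thesis
    using S(1,2) S(3)[OF n] f(1) by (intro bexI[of _ S] exI[of _ c]) auto
qed

section \<open>Invariance of the Runge--Kutta step\<close>

lemma pow_mat_intertwine:
  fixes L :: "complex mat"
  assumes L: "L \<in> carrier_mat n n" and M: "M \<in> carrier_mat m m" and S: "S \<in> carrier_mat n m"
    and LS: "L * S = S * M"
  shows "L ^\<^sub>m k * S = S * M ^\<^sub>m k"
proof (induction k)
  case 0
  then show ?case using L M S by simp
next
  case (Suc k)
  have "L ^\<^sub>m Suc k * S = L ^\<^sub>m k * (L * S)"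
    using L S by (simp add: assoc_mult_mat[of _ n n _ n _ m])
  also have "\<dots> = (L ^\<^sub>m k * S) * M"
    unfolding LS using L S M by (simp add: assoc_mult_mat[of _ n n _ m _ m])
  also have "\<dots> = S * M ^\<^sub>m Suc k"
    unfolding Suc using M S by (simp add: assoc_mult_mat[of _ n m _ m _ m])
  finally show ?case .
qed

text \<open>Each power intertwines, hence so does every linear combination. The sums are exchanged
  entrywise because \<open>poly_mat\<close> is given by entries.\<close>

lemma poly_mat_intertwine:
  assumes L: "L \<in> carrier_mat n n" and M: "M \<in> carrier_mat m m" and S: "S \<in> carrier_mat n m"
    and LS: "L * S = S * M"
  shows "poly_mat p L * S = S * poly_mat p M"
proof (intro eq_matI)
  fix i j assume "i < dim_row (S * poly_mat p M)" "j < dim_col (S * poly_mat p M)"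
  then have ij: "i < n" "j < m" using S M by (auto simp: poly_mat_def)
  have pow: "(\<Sum>l<n. (L ^\<^sub>m k) $$ (i, l) * S $$ (l, j)) = (\<Sum>l<m. S $$ (i, l) * (M ^\<^sub>m k) $$ (l, j))"
    for k
  proof -
    have "(L ^\<^sub>m k * S) $$ (i, j) = (S * M ^\<^sub>m k) $$ (i, j)"
      by (simp only: pow_mat_intertwine[OF L M S LS])
    then show ?thesis using L M S ij by (simp add: scalar_prod_def atLeast0LessThan)
  qed
  have "(poly_mat p L * S) $$ (i, j)
      = (\<Sum>l<n. (\<Sum>k\<le>degree p. coeff p k * (L ^\<^sub>m k) $$ (i, l)) * S $$ (l, j))"
    using L S ij by (simp add: poly_mat_def scalar_prod_def atLeast0LessThan)
  also have "\<dots> = (\<Sum>k\<le>degree p. coeff p k * (\<Sum>l<n. (L ^\<^sub>m k) $$ (i, l) * S $$ (l, j)))"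
    unfolding sum_distrib_left sum_distrib_right by (subst sum.swap) (simp add: ac_simps)
  also have "\<dots> = (\<Sum>l<m. S $$ (i, l) * (\<Sum>k\<le>degree p. coeff p k * (M ^\<^sub>m k) $$ (l, j)))"
    unfolding pow sum_distrib_left sum_distrib_right by (subst sum.swap) (simp add: ac_simps)
  also have "\<dots> = (S * poly_mat p M) $$ (i, j)"
    using M S ij by (simp add: poly_mat_def scalar_prod_def atLeast0LessThan)
  finally show "(poly_mat p L * S) $$ (i, j) = (S * poly_mat p M) $$ (i, j)" .
qed (use L M S in \<open>auto simp: poly_mat_def\<close>)

text \<open>One step applies a fixed polynomial to \<tau> times the matrix, so whatever intertwines
  \<open>L\<close> and \<open>M\<close> also intertwines their steps.\<close>

lemma rk_step_intertwine:
  assumes L: "L \<in> carrier_mat n n" and M: "M \<in> carrier_mat m m" and S: "S \<in> carrier_mat n m"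
    and LS: "L * S = S * M" and x: "x \<in> carrier_vec m"
  shows "rk_step s a b L \<tau> (S *\<^sub>v x) = S *\<^sub>v rk_step s a b M \<tau> x"
proof -
  let ?R = "stability_function s a b"
  let ?L = "complex_of_real \<tau> \<cdot>\<^sub>m L" and ?M = "complex_of_real \<tau> \<cdot>\<^sub>m M"
  have L': "?L \<in> carrier_mat n n" and M': "?M \<in> carrier_mat m m" using L M by auto
  have "?L * S = S * ?M"
    using L M S LS by (simp add: mult_smult_assoc_mat mult_smult_distrib)
  note I = poly_mat_intertwine[OF L' M' S this, of ?R]
  have Sx: "S *\<^sub>v x \<in> carrier_vec n" using S x by (rule mult_mat_vec_carrier)
  have "rk_step s a b L \<tau> (S *\<^sub>v x) = (poly_mat ?R ?L * S) *\<^sub>v x"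
    unfolding rk_step_eq_stability_function[OF L Sx]
    using assoc_mult_mat_vec[OF poly_mat_carrier[OF L'] S x] by simp
  also have "\<dots> = S *\<^sub>v rk_step s a b M \<tau> x"
    unfolding I rk_step_eq_stability_function[OF M x]
    by (rule assoc_mult_mat_vec[OF S poly_mat_carrier[OF M'] x])
  finally show ?thesis .
qed

lemma rk_step_carrier:
  assumes "L \<in> carrier_mat n n" "u \<in> carrier_vec n"
  shows "rk_step s a b L \<tau> u \<in> carrier_vec n"
  using assms by (simp add: rk_step_def)

section \<open>Orthogonal sums of two blocks\<close>

text \<open>The zero blocks take their shape from row counts alone, which fits square
  \<open>A\<close> and \<open>D\<close>.\<close>

abbreviation diag_block :: "complex mat \<Rightarrow> complex mat \<Rightarrow> complex mat" where
  "diag_block A D \<equiv> four_block_mat A (0\<^sub>m (dim_row A) (dim_row D)) (0\<^sub>m (dim_row D) (dim_row A)) D"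

lemma poly_mat_diag_block:
  assumes A: "A \<in> carrier_mat n n" and D: "D \<in> carrier_mat m m"
  shows "poly_mat p (diag_block A D) = diag_block (poly_mat p A) (poly_mat p D)"
proof (intro eq_matI)
  have pow: "diag_block A D ^\<^sub>m k = four_block_mat (A ^\<^sub>m k) (0\<^sub>m n m) (0\<^sub>m m n) (D ^\<^sub>m k)" for k
    using pow_four_block_mat[OF A D, of k] A D by auto
  fix i j assume "i < dim_row (diag_block (poly_mat p A) (poly_mat p D))"
    "j < dim_col (diag_block (poly_mat p A) (poly_mat p D))"
  then have "i < n + m" "j < n + m" using A D by (auto simp: poly_mat_def)
  then show "poly_mat p (diag_block A D) $$ (i, j)
      = diag_block (poly_mat p A) (poly_mat p D) $$ (i, j)"
    using A D by (auto simp: poly_mat_def pow pow_four_block_mat[OF A D] pow_mat_dim_square[OF A]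
        simp del: pow_mat_dim intro!: sum.cong)
qed (use A D in \<open>auto simp: poly_mat_def\<close>)

text \<open>Powers, and hence polynomials, of a block diagonal matrix are formed blockwise, so the
  two components evolve independently.\<close>

lemma rk_step_diag_block:
  assumes A: "A \<in> carrier_mat n n" and D: "D \<in> carrier_mat m m"
    and x: "x \<in> carrier_vec n" and y: "y \<in> carrier_vec m"
  shows "rk_step s a b (diag_block A D) \<tau> (x @\<^sub>v y)
       = rk_step s a b A \<tau> x @\<^sub>v rk_step s a b D \<tau> y"
proof -
  let ?c = "complex_of_real \<tau>" and ?R = "stability_function s a b"
  have B: "diag_block A D \<in> carrier_mat (n + m) (n + m)" and xy: "x @\<^sub>v y \<in> carrier_vec (n + m)"
    using A D x y by auto
  have cA: "?c \<cdot>\<^sub>m A \<in> carrier_mat n n" and cD: "?c \<cdot>\<^sub>m D \<in> carrier_mat m m" using A D by auto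
  have RA: "poly_mat ?R (?c \<cdot>\<^sub>m A) \<in> carrier_mat n n" and RD: "poly_mat ?R (?c \<cdot>\<^sub>m D) \<in> carrier_mat m m"
    using cA cD by (auto intro: poly_mat_carrier)
  have "?c \<cdot>\<^sub>m diag_block A D = diag_block (?c \<cdot>\<^sub>m A) (?c \<cdot>\<^sub>m D)"
    using A D by (intro eq_matI) auto
  then have "rk_step s a b (diag_block A D) \<tau> (x @\<^sub>v y)
      = diag_block (poly_mat ?R (?c \<cdot>\<^sub>m A)) (poly_mat ?R (?c \<cdot>\<^sub>m D)) *\<^sub>v (x @\<^sub>v y)"
    using rk_step_eq_stability_function[OF B xy] poly_mat_diag_block[OF cA cD] by simp
  also have "\<dots> = poly_mat ?R (?c \<cdot>\<^sub>m A) *\<^sub>v x @\<^sub>v poly_mat ?R (?c \<cdot>\<^sub>m D) *\<^sub>v y"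
    using mult_mat_vec_split[OF RA RD x y] RA RD by simp
  finally show ?thesis
    unfolding rk_step_eq_stability_function[OF A x] rk_step_eq_stability_function[OF D y] .
qed

section \<open>Change of coordinates to a frame orthonormal for \<open>P\<close>\<close>

text \<open>Moving \<open>S\<close> to the other factor as its adjoint produces
  \<open>mat_adjoint S * (P * S)\<close>, which is the identity: \<open>S\<close> is an isometry
  from the Euclidean inner product to that of \<open>P\<close>.\<close>

lemma cscalar_prod_frame:
  fixes P S :: "complex mat"
  assumes P: "P \<in> carrier_mat n n" and S: "S \<in> carrier_mat n n"
    and SPS: "mat_adjoint S * (P * S) = 1\<^sub>m n"
    and y: "y \<in> carrier_vec n" and x: "x \<in> carrier_vec n"
  shows "(P *\<^sub>v (S *\<^sub>v y)) \<bullet>c (S *\<^sub>v x) = y \<bullet>c x"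
proof -
  have Sx: "S *\<^sub>v x \<in> carrier_vec n" and Sy: "S *\<^sub>v y \<in> carrier_vec n"
    using S x y by (auto intro: mult_mat_vec_carrier)
  have PSy: "P *\<^sub>v (S *\<^sub>v y) \<in> carrier_vec n" using P Sy by (rule mult_mat_vec_carrier)
  have Sa: "mat_adjoint S \<in> carrier_mat n n" using S by simp
  have "(S *\<^sub>v x) \<bullet>c (P *\<^sub>v (S *\<^sub>v y)) = x \<bullet>c (mat_adjoint S *\<^sub>v (P *\<^sub>v (S *\<^sub>v y)))"
    by (rule cscalar_prod_mat_adjoint[OF S x PSy])
  also have "mat_adjoint S *\<^sub>v (P *\<^sub>v (S *\<^sub>v y)) = (mat_adjoint S * (P * S)) *\<^sub>v y"
    using assoc_mult_mat_vec[OF P S y] assoc_mult_mat_vec[OF Sa _ y, of "P * S"] P S by simp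
  also have "\<dots> = y" unfolding SPS using y by simp
  finally show ?thesis
    using cscalar_prod_commute[OF Sx PSy] cscalar_prod_commute[OF x y] by simp
qed

lemma weighted_norm_frame:
  assumes "P \<in> carrier_mat n n" "S \<in> carrier_mat n n" "mat_adjoint S * (P * S) = 1\<^sub>m n"
    and x: "x \<in> carrier_vec n"
  shows "weighted_norm P (S *\<^sub>v x) = euclidean_norm x"
  using cscalar_prod_frame[OF assms(1-3) x x] weighted_norm_one[OF x] x
  by (simp add: weighted_norm_def)

text \<open>The frame identity makes \<open>mat_adjoint S * P\<close> a left inverse of
  \<open>S\<close>; for square matrices it is then also a right inverse.\<close>

lemma frame_inverse:
  fixes P S :: "complex mat"
  assumes P: "P \<in> carrier_mat n n" and S: "S \<in> carrier_mat n n"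
    and SPS: "mat_adjoint S * (P * S) = 1\<^sub>m n"
  shows "S * (mat_adjoint S * P) = 1\<^sub>m n"
proof -
  have "(mat_adjoint S * P) * S = 1\<^sub>m n"
    unfolding assoc_mult_mat[OF mat_adjoint_carrier[OF S] P S] by (rule SPS)
  moreover have "mat_adjoint S * P \<in> carrier_mat n n" using P S by auto
  ultimately show ?thesis using mat_mult_left_right_inverse S by blast
qed

lemma frame_range:
  fixes P S :: "complex mat"
  assumes P: "P \<in> carrier_mat n n" and S: "S \<in> carrier_mat n n"
    and SPS: "mat_adjoint S * (P * S) = 1\<^sub>m n" and u: "u \<in> carrier_vec n"
  shows "\<exists>x \<in> carrier_vec n. u = S *\<^sub>v x"
proof -
  have T: "mat_adjoint S * P \<in> carrier_mat n n" using P S by auto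
  have "u = S *\<^sub>v ((mat_adjoint S * P) *\<^sub>v u)"
    using assoc_mult_mat_vec[OF S T u] frame_inverse[OF P S SPS] u by simp
  then show ?thesis using mult_mat_vec_carrier[OF T u] by blast
qed

text \<open>The witness is the conjugate of \<open>L\<close> by \<open>S\<close>, with
  \<open>mat_adjoint S * P\<close> as the inverse of \<open>S\<close>.\<close>

lemma frame_conjugate:
  fixes P S L :: "complex mat"
  assumes P: "P \<in> carrier_mat n n" and S: "S \<in> carrier_mat n n"
    and SPS: "mat_adjoint S * (P * S) = 1\<^sub>m n" and L: "L \<in> carrier_mat n n"
  shows "\<exists>M \<in> carrier_mat n n. L * S = S * M"
proof -
  let ?T = "mat_adjoint S * P"
  have T: "?T \<in> carrier_mat n n" using P S by auto
  have LS: "L * S \<in> carrier_mat n n" using L S by auto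
  have "S * (?T * (L * S)) = L * S"
    unfolding assoc_mult_mat[OF S T LS, symmetric] frame_inverse[OF P S SPS]
    by (rule left_mult_one_mat[OF LS])
  then show ?thesis using T LS by (intro bexI[of _ "?T * (L * S)"]) auto
qed

text \<open>The Euclidean form of \<open>M\<close> at \<open>x\<close> equals the form of
  \<open>P * L\<close> at \<open>S *\<^sub>v x\<close>, since \<open>S\<close> is an
  isometry.\<close>

lemma semi_dissipative_frame:
  assumes P: "P \<in> carrier_mat n n" and S: "S \<in> carrier_mat n n"
    and SPS: "mat_adjoint S * (P * S) = 1\<^sub>m n"
    and L: "L \<in> carrier_mat n n" and M: "M \<in> carrier_mat n n" and LS: "L * S = S * M"
    and diss: "\<And>x. x \<in> carrier_vec n \<Longrightarrow> Re ((P *\<^sub>v (L *\<^sub>v x)) \<bullet>c x) \<le> 0"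
  shows "semi_dissipative M"
  unfolding semi_dissipative_iff[OF M]
proof
  fix x :: "complex vec" assume x: "x \<in> carrier_vec n"
  have "L *\<^sub>v (S *\<^sub>v x) = S *\<^sub>v (M *\<^sub>v x)"
    using assoc_mult_mat_vec[OF L S x] assoc_mult_mat_vec[OF S M x] LS by simp
  then have "(P *\<^sub>v (L *\<^sub>v (S *\<^sub>v x))) \<bullet>c (S *\<^sub>v x) = (M *\<^sub>v x) \<bullet>c x"
    using cscalar_prod_frame[OF P S SPS mult_mat_vec_carrier[OF M x] x] by simp
  then show "Re ((M *\<^sub>v x) \<bullet>c x) \<le> 0"
    using diss[OF mult_mat_vec_carrier[OF S x]] by simp
qed

text \<open>Every \<open>u\<close> is \<open>S *\<^sub>v x\<close> for some \<open>x\<close>, and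
  \<open>S\<close> preserves norms and commutes with the steps, so a bound on the time step for
  \<open>M\<close> also serves \<open>L\<close>.\<close>

lemma weighted_contractive_frame:
  assumes P: "P \<in> carrier_mat n n" and S: "S \<in> carrier_mat n n"
    and SPS: "mat_adjoint S * (P * S) = 1\<^sub>m n"
    and L: "L \<in> carrier_mat n n" and M: "M \<in> carrier_mat n n" and LS: "L * S = S * M"
    and st: "strongly_stable_wrt s a b {M}"
  shows "\<exists>\<tau>\<^sub>0 > 0. \<forall>\<tau>. 0 < \<tau> \<and> \<tau> \<le> \<tau>\<^sub>0 \<longrightarrow>
     (\<forall>u \<in> carrier_vec n. weighted_norm P (rk_step s a b L \<tau> u) \<le> weighted_norm P u)"
proof -
  have "weighted_norm P (rk_step s a b L \<tau> u) \<le> weighted_norm P u"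
    if *: "\<And>x. x \<in> carrier_vec n \<Longrightarrow> euclidean_norm (rk_step s a b M \<tau> x) \<le> euclidean_norm x"
      and u: "u \<in> carrier_vec n" for \<tau> u
  proof -
    obtain x where x: "x \<in> carrier_vec n" and ux: "u = S *\<^sub>v x"
      using frame_range[OF P S SPS u] by blast
    show ?thesis
      unfolding ux rk_step_intertwine[OF L M S LS x]
        weighted_norm_frame[OF P S SPS x] weighted_norm_frame[OF P S SPS rk_step_carrier[OF M x]]
      by (rule *[OF x])
  qed
  moreover obtain \<tau>\<^sub>0 where "\<tau>\<^sub>0 > 0"
    "\<And>\<tau> x. 0 < \<tau> \<Longrightarrow> \<tau> \<le> \<tau>\<^sub>0 \<Longrightarrow> x \<in> carrier_vec n \<Longrightarrow>
       euclidean_norm (rk_step s a b M \<tau> x) \<le> euclidean_norm x"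
    using st M by (auto simp: strongly_stable_wrt_def)
  ultimately show ?thesis by (intro exI[of _ \<tau>\<^sub>0]) auto
qed

section \<open>Stability of unitary conjugates and orthogonal sums\<close>

lemma euclidean_norm_append:
  "(euclidean_norm (x @\<^sub>v y))\<^sup>2 = (euclidean_norm x)\<^sup>2 + (euclidean_norm y)\<^sup>2"
proof -
  \<comment> \<open>The variable length \<open>k\<close> of the second part allows induction with
    \<open>y\<close> kept fixed.\<close>
  have "(\<Sum>i<dim_vec x + k. (cmod ((x @\<^sub>v y) $ i))\<^sup>2)
      = (\<Sum>i<dim_vec x. (cmod (x $ i))\<^sup>2) + (\<Sum>i<k. (cmod (y $ i))\<^sup>2)" if "k \<le> dim_vec y" for k
    using that by (induction k) auto
  then show ?thesis by (simp add: euclidean_norm_def sum_nonneg)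
qed

lemma strongly_stable_wrt_mono:
  "strongly_stable_wrt s a b \<L> \<Longrightarrow> \<M> \<subseteq> \<L> \<Longrightarrow> strongly_stable_wrt s a b \<M>"
  unfolding strongly_stable_wrt_def by blast

lemma strongly_stable_wrt_singleton:
  assumes "L \<in> carrier_mat n n"
  shows "strongly_stable_wrt s a b {L} \<longleftrightarrow>
    (\<exists>\<tau>\<^sub>0 > 0. \<forall>\<tau>. 0 < \<tau> \<and> \<tau> \<le> \<tau>\<^sub>0 \<longrightarrow>
      (\<forall>u \<in> carrier_vec n. weighted_norm (1\<^sub>m n) (rk_step s a b L \<tau> u) \<le> weighted_norm (1\<^sub>m n) u))"
  using assms rk_step_carrier[OF assms] by (simp add: strongly_stable_wrt_def weighted_norm_one)

text \<open>A unitary \<open>S\<close> is a frame for \<open>P = I\<close>, whose weighted norm is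
  the Euclidean one.\<close>

lemma strongly_stable_wrt_unitary:
  assumes S: "S \<in> carrier_mat n n" "mat_adjoint S * S = 1\<^sub>m n"
    and L: "L \<in> carrier_mat n n" and M: "M \<in> carrier_mat n n" and LS: "L * S = S * M"
    and st: "strongly_stable_wrt s a b {M}"
  shows "strongly_stable_wrt s a b {L}"
  unfolding strongly_stable_wrt_singleton[OF L]
  using S by (intro weighted_contractive_frame[OF _ S(1) _ L M LS st]) auto

text \<open>Squared norms of the components add up, so contractivity of both blocks gives that of
  the sum as soon as \<tau> is below both bounds.\<close>

lemma strongly_stable_wrt_diag_block:
  assumes A: "A \<in> carrier_mat n n" and D: "D \<in> carrier_mat m m"
    and stA: "strongly_stable_wrt s a b {A}" and stD: "strongly_stable_wrt s a b {D}"
  shows "strongly_stable_wrt s a b {diag_block A D}"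
proof -
  obtain \<tau>1 where 1: "\<tau>1 > 0"
    "\<And>\<tau> x. 0 < \<tau> \<Longrightarrow> \<tau> \<le> \<tau>1 \<Longrightarrow> x \<in> carrier_vec n \<Longrightarrow>
       euclidean_norm (rk_step s a b A \<tau> x) \<le> euclidean_norm x"
    using stA A by (auto simp: strongly_stable_wrt_def)
  obtain \<tau>2 where 2: "\<tau>2 > 0"
    "\<And>\<tau> x. 0 < \<tau> \<Longrightarrow> \<tau> \<le> \<tau>2 \<Longrightarrow> x \<in> carrier_vec m \<Longrightarrow>
       euclidean_norm (rk_step s a b D \<tau> x) \<le> euclidean_norm x"
    using stD D by (auto simp: strongly_stable_wrt_def)
  have "euclidean_norm (rk_step s a b (diag_block A D) \<tau> (x @\<^sub>v y)) \<le> euclidean_norm (x @\<^sub>v y)"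
    if t: "0 < \<tau>" "\<tau> \<le> min \<tau>1 \<tau>2" and x: "x \<in> carrier_vec n" and y: "y \<in> carrier_vec m" for \<tau> x y
  proof (rule power2_le_imp_le)
    have nn: "0 \<le> euclidean_norm z" for z by (simp add: euclidean_norm_def sum_nonneg)
    show "0 \<le> euclidean_norm (x @\<^sub>v y)" by (rule nn)
    show "(euclidean_norm (rk_step s a b (diag_block A D) \<tau> (x @\<^sub>v y)))\<^sup>2
        \<le> (euclidean_norm (x @\<^sub>v y))\<^sup>2"
      unfolding rk_step_diag_block[OF A D x y] euclidean_norm_append
      using t 1(2)[of \<tau> x] 2(2)[of \<tau> y] x y nn by (intro add_mono power_mono) auto
  qed
  \<comment> \<open>Every vector of length \<open>n + m\<close> is the concatenation of vectors of
    lengths \<open>n\<close> and \<open>m\<close>.\<close>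
  then have "\<forall>u \<in> carrier_vec (n + m).
      euclidean_norm (rk_step s a b (diag_block A D) \<tau> u) \<le> euclidean_norm u"
    if "0 < \<tau>" "\<tau> \<le> min \<tau>1 \<tau>2" for \<tau>
    using that unfolding all_vec_append by blast
  then show ?thesis
    using 1(1) 2(1) A D unfolding strongly_stable_wrt_def
    by (auto intro!: exI[of _ "min \<tau>1 \<tau>2"])
qed

section \<open>Splitting off imaginary eigenvalues\<close>

text \<open>At an eigenvector the quadratic form is \<mu> times the squared norm, which is real and
  positive.\<close>

lemma semi_dissipative_eigenvalue:
  assumes L: "L \<in> carrier_mat n n" "semi_dissipative L" and ev: "eigenvector L v \<mu>"
  shows "Re \<mu> \<le> 0"
proof -
  have v: "v \<in> carrier_vec n" "v \<noteq> 0\<^sub>v n" "L *\<^sub>v v = \<mu> \<cdot>\<^sub>v v"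
    using ev L by (auto simp: eigenvector_def)
  have "Re (\<mu> * (v \<bullet>c v)) \<le> 0"
    using L v by (auto simp: semi_dissipative_iff cscalar_prod_smult_left)
  moreover have "Im (v \<bullet>c v) = 0"
    using cscalar_prod_commute[OF v(1,1)] by (metis Reals_cnj_iff complex_is_Real_iff)
  ultimately show ?thesis
    using Re_cscalar_prod_self_pos[OF v(1,2)] by (simp add: mult_le_0_iff)
qed

text \<open>If the claim failed, \<open>\<langle>x, L x\<rangle>\<close> would have positive real part at \<open>x = z v + w\<close> for \<open>z\<close> a
  large multiple of \<open>\<langle>v, L w\<rangle>\<close>.\<close>

lemma semi_dissipative_orthogonal:
  assumes L: "L \<in> carrier_mat n n" "semi_dissipative L"
    and v: "v \<in> carrier_vec n" "L *\<^sub>v v = \<mu> \<cdot>\<^sub>v v" "Re \<mu> = 0"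
    and w: "w \<in> carrier_vec n" "v \<bullet>c w = 0"
  shows "(L *\<^sub>v w) \<bullet>c v = 0"
proof -
  have Lw: "L *\<^sub>v w \<in> carrier_vec n" using L w by (auto intro: mult_mat_vec_carrier)
  define q where "q = (L *\<^sub>v w) \<bullet>c v"
  define r where "r = Re ((L *\<^sub>v w) \<bullet>c w)"
  have vv: "Im (v \<bullet>c v) = 0"
    using cscalar_prod_commute[OF v(1,1)] by (metis Reals_cnj_iff complex_is_Real_iff)
  have "t * (cmod q)\<^sup>2 + r \<le> 0" for t :: real
  proof -
    define z where "z = complex_of_real t * q"
    have zv: "z \<cdot>\<^sub>v v \<in> carrier_vec n" using v by simp
    have "L *\<^sub>v (z \<cdot>\<^sub>v v + w) = (z * \<mu>) \<cdot>\<^sub>v v + L *\<^sub>v w"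
      using mult_add_distrib_mat_vec[OF L(1) zv w(1)] mult_mat_vec_smult[OF L(1) v(1)] v
      by (simp add: smult_smult_assoc)
    then have "(L *\<^sub>v (z \<cdot>\<^sub>v v + w)) \<bullet>c (z \<cdot>\<^sub>v v + w)
        = z * \<mu> * (cnj z * (v \<bullet>c v)) + cnj z * q + (L *\<^sub>v w) \<bullet>c w"
      using v w Lw by (simp add: cscalar_prod_linear[of _ n] q_def algebra_simps)
    \<comment> \<open>The term is \<mu> times the real number
      \<open>(cmod z)\<^sup>2 * Re (v \<bullet>c v)\<close>, and \<mu> is purely imaginary.\<close>
    moreover have "Re (z * \<mu> * (cnj z * (v \<bullet>c v))) = 0"
    proof -
      have "v \<bullet>c v = complex_of_real (Re (v \<bullet>c v))" using vv by (simp add: complex_eq_iff)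
      then have "z * \<mu> * (cnj z * (v \<bullet>c v)) = (z * cnj z) * complex_of_real (Re (v \<bullet>c v)) * \<mu>"
        by (metis mult.assoc mult.commute)
      also have "\<dots> = complex_of_real ((cmod z)\<^sup>2 * Re (v \<bullet>c v)) * \<mu>"
        unfolding complex_norm_square[symmetric] by simp
      finally have "z * \<mu> * (cnj z * (v \<bullet>c v)) = complex_of_real ((cmod z)\<^sup>2 * Re (v \<bullet>c v)) * \<mu>" .
      then show ?thesis by (simp only: v(3) Im_complex_of_real times_complex.sel mult_zero_left mult_zero_right diff_0_right)
    qed
    moreover have "Re (cnj z * q) = t * (cmod q)\<^sup>2"
      unfolding cmod_power2 by (simp add: z_def power2_eq_square algebra_simps)
    moreover have "Re ((L *\<^sub>v (z \<cdot>\<^sub>v v + w)) \<bullet>c (z \<cdot>\<^sub>v v + w)) \<le> 0"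
      using L semi_dissipative_iff[OF L(1)] zv w by auto
    ultimately show ?thesis by (simp add: r_def)
  qed
  note * = this
  have "q = 0"
  proof (rule ccontr)
    assume "q \<noteq> 0"
    \<comment> \<open>This value of \<open>t\<close> turns the left side of the bound into
      1.\<close>
    then show False using *[of "(1 - r) / (cmod q)\<^sup>2"] by simp
  qed
  then show ?thesis by (simp add: q_def)
qed

text \<open>Testing the form of the sum on vectors whose first part is zero leaves the form of
  \<open>D\<close>.\<close>

lemma semi_dissipative_diag_block:
  assumes A: "A \<in> carrier_mat n n" and D: "D \<in> carrier_mat m m"
    and diss: "semi_dissipative (diag_block A D)"
  shows "semi_dissipative D"
  unfolding semi_dissipative_iff[OF D]
proof
  fix y :: "complex vec" assume y: "y \<in> carrier_vec m"
  have B: "diag_block A D \<in> carrier_mat (n + m) (n + m)" using A D by auto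
  have Dy: "D *\<^sub>v y \<in> carrier_vec m" using D y by (rule mult_mat_vec_carrier)
  have A0: "A *\<^sub>v 0\<^sub>v n = 0\<^sub>v n" using A by (intro eq_vecI) auto
  have "diag_block A D *\<^sub>v (0\<^sub>v n @\<^sub>v y) = 0\<^sub>v n @\<^sub>v D *\<^sub>v y"
    using mult_mat_vec_split[OF A D zero_carrier_vec y] A D A0 by simp
  moreover have "conjugate (0\<^sub>v n @\<^sub>v y) = 0\<^sub>v n @\<^sub>v conjugate y"
    by (intro eq_vecI) auto
  ultimately have "(diag_block A D *\<^sub>v (0\<^sub>v n @\<^sub>v y)) \<bullet>c (0\<^sub>v n @\<^sub>v y) = (D *\<^sub>v y) \<bullet>c y"
    using scalar_prod_append[of "0\<^sub>v n" n "D *\<^sub>v y" m "0\<^sub>v n" "conjugate y"] Dy y by simp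
  moreover have "0\<^sub>v n @\<^sub>v y \<in> carrier_vec (n + m)" using y by simp
  ultimately show "Re ((D *\<^sub>v y) \<bullet>c y) \<le> 0"
    using diss semi_dissipative_iff[OF B] by metis
qed

text \<open>In a unitary basis that starts with a multiple of an eigenvector, the first column
  vanishes below the diagonal. Semi-dissipativity then clears the first row, which leaves a block
  diagonal matrix.\<close>

lemma unitary_split_imaginary_eigenvalue:
  assumes L: "L \<in> carrier_mat (Suc m) (Suc m)" "semi_dissipative L"
    and ev: "eigenvalue L \<mu>" and \<mu>: "Re \<mu> = 0"
  shows "\<exists>S \<in> carrier_mat (Suc m) (Suc m). \<exists>D \<in> carrier_mat m m.
     mat_adjoint S * S = 1\<^sub>m (Suc m) \<and> L * S = S * diag_block (mat 1 1 (\<lambda>_. \<mu>)) D \<and>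
     semi_dissipative D"
proof -
  let ?n = "Suc m" and ?A = "mat 1 1 (\<lambda>_. \<mu>)"
  obtain v where v: "v \<in> carrier_vec ?n" "v \<noteq> 0\<^sub>v ?n" "L *\<^sub>v v = \<mu> \<cdot>\<^sub>v v"
    using ev L by (auto simp: eigenvalue_def eigenvector_def)
  obtain S c where S: "S \<in> carrier_mat ?n ?n" "mat_adjoint S * S = 1\<^sub>m ?n" and Sv: "col S 0 = c \<cdot>\<^sub>v v"
    using exists_unitary_with_first_col[OF v(1,2)] by blast
  \<comment> \<open>The factor \<open>1\<^sub>m ?n\<close> gives the unitary \<open>S\<close> the
    shape of a frame for \<open>P = I\<close>.\<close>
  have I: "1\<^sub>m ?n \<in> carrier_mat ?n ?n" and SS: "mat_adjoint S * (1\<^sub>m ?n * S) = 1\<^sub>m ?n"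
    using S by auto
  obtain M where M: "M \<in> carrier_mat ?n ?n" and LS: "L * S = S * M"
    using frame_conjugate[OF I S(1) SS L(1)] by blast
  have "Re ((1\<^sub>m ?n *\<^sub>v (L *\<^sub>v x)) \<bullet>c x) \<le> 0" if "x \<in> carrier_vec ?n" for x
    using L semi_dissipative_iff[OF L(1)] that mult_mat_vec_carrier[OF L(1) that] by simp
  then have Mdiss: "semi_dissipative M"
    by (rule semi_dissipative_frame[OF I S(1) SS L(1) M LS])
  let ?e = "unit_vec ?n :: nat \<Rightarrow> complex vec"
  \<comment> \<open>\<open>S\<close> sends the first unit vector to a multiple of the eigenvector
    \<open>v\<close>; after \<open>L\<close> has acted, \<open>mat_adjoint S\<close> cancels
    \<open>S\<close>.\<close>
  have Me0: "M *\<^sub>v ?e 0 = \<mu> \<cdot>\<^sub>v ?e 0"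
  proof -
    have Se0: "S *\<^sub>v ?e 0 = c \<cdot>\<^sub>v v" using mult_mat_unit_vec[OF S(1), of 0] Sv by simp
    have "S *\<^sub>v (M *\<^sub>v ?e 0) = L *\<^sub>v (S *\<^sub>v ?e 0)"
      using assoc_mult_mat_vec[OF L(1) S(1), of "?e 0"] assoc_mult_mat_vec[OF S(1) M, of "?e 0"] LS by simp
    also have "\<dots> = S *\<^sub>v (\<mu> \<cdot>\<^sub>v ?e 0)"
      unfolding mult_mat_vec_smult[OF S(1) unit_vec_carrier] Se0 mult_mat_vec_smult[OF L(1) v(1)] v(3)
      by (simp add: smult_smult_assoc mult.commute)
    finally have "mat_adjoint S *\<^sub>v (S *\<^sub>v (M *\<^sub>v ?e 0)) = mat_adjoint S *\<^sub>v (S *\<^sub>v (\<mu> \<cdot>\<^sub>v ?e 0))"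
      by simp
    then show ?thesis
      using assoc_mult_mat_vec[OF mat_adjoint_carrier[OF S(1)] S(1), symmetric] S(2) M
        mult_mat_vec_carrier[OF M unit_vec_carrier] by simp
  qed
  have M_index: "M $$ (i, j) = (M *\<^sub>v ?e j) $ i" if "i < ?n" "j < ?n" for i j
    using that M mult_mat_unit_vec[OF M that(2)] by simp
  have col0: "M $$ (i, 0) = (if i = 0 then \<mu> else 0)" if "i < ?n" for i
    unfolding M_index[OF that zero_less_Suc] Me0 using that by simp
  \<comment> \<open>The vector \<open>?e j\<close> is orthogonal to the eigenvector
    \<open>?e 0\<close> of \<open>M\<close>, hence its image has no component along
    \<open>?e 0\<close>.\<close>
  have row0: "M $$ (0, j) = 0" if j: "0 < j" "j < ?n" for j
  proof -
    have "?e 0 \<bullet>c ?e j = 0"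
      using j by (simp add: cscalar_prod_sum[of _ ?n] unit_vec_def)
    from semi_dissipative_orthogonal[OF M Mdiss unit_vec_carrier Me0 \<mu> unit_vec_carrier this]
    have "(M *\<^sub>v ?e j) \<bullet>c ?e 0 = 0" .
    moreover have "conjugate (?e 0) = ?e 0" by (intro eq_vecI) (auto simp: unit_vec_def)
    ultimately show ?thesis
      using M_index[of 0 j] j mult_mat_vec_carrier[OF M unit_vec_carrier] by simp
  qed
  define D where "D = mat m m (\<lambda>(i, j). M $$ (Suc i, Suc j))"
  have D: "D \<in> carrier_mat m m" by (simp add: D_def)
  have MD: "M = diag_block ?A D"
    using M col0 row0 by (intro eq_matI) (auto simp: D_def)
  have "semi_dissipative D"
    using semi_dissipative_diag_block[of ?A 1 D m] D Mdiss[unfolded MD] by simp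
  then show ?thesis using S D LS[unfolded MD] by blast
qed

text \<open>Induction on the dimension: an eigenvalue on the imaginary axis is split off as a scalar
  from \<open>L_IM\<close>, leaving a smaller semi-dissipative block. Without such an eigenvalue the
  matrix lies in \<open>L_AS\<close>.\<close>

lemma strongly_stable_wrt_semi_dissipative:
  assumes AS: "strongly_stable_wrt s a b L_AS" and IM: "strongly_stable_wrt s a b L_IM"
    and "L \<in> carrier_mat n n" "semi_dissipative L"
  shows "strongly_stable_wrt s a b {L}"
  using assms(3,4)
proof (induction n arbitrary: L)
  case 0
  \<comment> \<open>A matrix of dimension 0 has no eigenvalues, so it is asymptotically stable
    vacuously.\<close>
  then have "L \<in> L_AS"
    using eigenvalue_imp_nonzero_dim[of L 0]
    by (auto simp: L_AS_def asymptotically_stable_def)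
  then show ?case using strongly_stable_wrt_mono[OF AS] by simp
next
  case (Suc m)
  show ?case
  proof (cases "\<exists>\<mu>. eigenvalue L \<mu> \<and> Re \<mu> = 0")
    case False
    then have "L \<in> L_AS"
      using Suc.prems semi_dissipative_eigenvalue[OF Suc.prems]
      by (force simp: L_AS_def asymptotically_stable_def eigenvalue_def)
    then show ?thesis using strongly_stable_wrt_mono[OF AS] by simp
  next
    case True
    then obtain \<mu> where \<mu>: "eigenvalue L \<mu>" "Re \<mu> = 0" by blast
    let ?A = "mat 1 1 (\<lambda>_. \<mu>)"
    obtain S D where S: "S \<in> carrier_mat (Suc m) (Suc m)" "mat_adjoint S * S = 1\<^sub>m (Suc m)"
      and D: "D \<in> carrier_mat m m" "semi_dissipative D" and LS: "L * S = S * diag_block ?A D"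
      using unitary_split_imaginary_eigenvalue[OF Suc.prems \<mu>] by blast
    have A: "?A \<in> carrier_mat 1 1" by simp
    have "?A \<in> L_IM" using \<mu> by (simp add: L_IM_def)
    then have "strongly_stable_wrt s a b {?A}"
      using strongly_stable_wrt_mono[OF IM] by simp
    from strongly_stable_wrt_diag_block[OF A D(1) this Suc.IH[OF D]]
    have st: "strongly_stable_wrt s a b {diag_block ?A D}" .
    have "diag_block ?A D \<in> carrier_mat (Suc m) (Suc m)" using D by auto
    from strongly_stable_wrt_unitary[OF S Suc.prems(1) this LS st] show ?thesis .
  qed
qed

section \<open>Strong stability restricted to the two test sets, and the equivalence\<close>

text \<open>The only eigenvalue is the entry itself. Its algebraic multiplicity is 1, and so is its
  geometric one, the characteristic matrix being zero.\<close>

lemma lyapunov_stable_one_dim: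
  assumes L: "L \<in> carrier_mat 1 1" and Re: "Re (L $$ (0, 0)) \<le> 0"
  shows "lyapunov_stable L"
  unfolding lyapunov_stable_def
proof (intro allI impI)
  fix \<mu> assume ev: "eigenvalue L \<mu>"
  have cp: "char_poly L = [:- (L $$ (0, 0)), 1:]"
    using L by (subst char_poly_upper_triangular[OF L]) (auto simp: diag_mat_def)
  have \<mu>: "\<mu> = L $$ (0, 0)"
    using ev eigenvalue_root_char_poly[OF L] by (simp add: cp)
  have "char_matrix L \<mu> = 0\<^sub>m 1 1"
    using L by (intro eq_matI) (auto simp: char_matrix_def \<mu>)
  moreover have "kernel_dim (0\<^sub>m 1 1 :: complex mat) = 1"
  proof -
    \<comment> \<open>The pivot value 1 is the number of columns, the convention for a row without
      pivot.\<close>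
    have "row_echelon_form (0\<^sub>m 1 1 :: complex mat)"
      by (auto simp: row_echelon_form_def pivot_fun_def intro!: exI[of _ "\<lambda>_. 1"])
    from find_base_vectors(6)[OF this zero_carrier_mat] show ?thesis
      by (simp add: kernel_dim_def Collect_conv_if cong: conj_cong)
  qed
  moreover have "Polynomial.order \<mu> (char_poly L) = 1"
    unfolding cp \<mu> using order_power_n_n[of "L $$ (0, 0)" 1] by simp
  ultimately show "Re \<mu> \<le> 0 \<and> (Re \<mu> = 0 \<longrightarrow> non_defective L \<mu>)"
    using Re by (simp add: non_defective_def \<mu>)
qed

text \<open>For a semi-dissipative \<open>L\<close> the choice \<open>P = I\<close> is admissible,
  and its norm is the Euclidean one.\<close>

lemma strongly_stable_imp_singleton:
  assumes ss: "strongly_stable s a b" and L: "L \<in> carrier_mat n n"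
    and "lyapunov_stable L" "semi_dissipative L"
  shows "strongly_stable_wrt s a b {L}"
proof -
  have "negative_semidefinite (mat_adjoint L * 1\<^sub>m n + 1\<^sub>m n * L)"
    using L positive_definite_one[of n] assms(4) mult_mat_vec_carrier[OF L]
    by (subst negative_semidefinite_lyapunov_iff[OF L])
       (auto simp: positive_definite_def semi_dissipative_iff)
  then show ?thesis
    unfolding strongly_stable_wrt_singleton[OF L]
    using ss L assms(3) positive_definite_one[of n] one_carrier_mat[of n]
    unfolding strongly_stable_def by blast
qed

theorem theorem1:
  fixes s :: nat
    and a :: "nat \<Rightarrow> nat \<Rightarrow> complex"
    and b :: "nat \<Rightarrow> complex"
  shows "strongly_stable s a b \<longleftrightarrow>
         strongly_stable_wrt s a b L_AS \<and> strongly_stable_wrt s a b L_IM"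
proof (intro iffI conjI)
  assume ss: "strongly_stable s a b"
  have "strongly_stable_wrt s a b {L}" if L_AS: "L \<in> L_AS" for L
  proof -
    obtain n where L: "L \<in> carrier_mat n n" "asymptotically_stable L" "semi_dissipative L"
      using L_AS unfolding L_AS_def by blast
    then have "lyapunov_stable L"
      unfolding lyapunov_stable_def asymptotically_stable_def
      \<comment> \<open>All eigenvalues have negative real part, so the condition on imaginary ones
        is vacuous.\<close>
      by (metis less_eq_real_def less_irrefl)
    then show ?thesis using strongly_stable_imp_singleton[OF ss L(1)] L(3) by blast
  qed
  then show "strongly_stable_wrt s a b L_AS" by (simp add: strongly_stable_wrt_def)
  have "strongly_stable_wrt s a b {L}" if L_IM: "L \<in> L_IM" for L
  proof -
    have L: "L \<in> carrier_mat 1 1" "Re (L $$ (0, 0)) = 0" using L_IM by (auto simp: L_IM_def)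
    have "semi_dissipative L"
      unfolding semi_dissipative_iff[OF L(1)]
    proof
      fix x :: "complex vec" assume x: "x \<in> carrier_vec 1"
      \<comment> \<open>The form is the imaginary entry of \<open>L\<close> times
        \<open>(cmod (x $ 0))\<^sup>2\<close>, so its real part is zero.\<close>
      show "Re ((L *\<^sub>v x) \<bullet>c x) \<le> 0"
        using L x by (simp add: cscalar_prod_sum[of _ 1] scalar_prod_def algebra_simps)
    qed
    then show ?thesis
      using strongly_stable_imp_singleton[OF ss L(1)] lyapunov_stable_one_dim[OF L(1)] L(2) by simp
  qed
  then show "strongly_stable_wrt s a b L_IM" by (simp add: strongly_stable_wrt_def)
next
  assume st: "strongly_stable_wrt s a b L_AS \<and> strongly_stable_wrt s a b L_IM"
  show "strongly_stable s a b"
    unfolding strongly_stable_def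
  proof (intro allI ballI impI, elim conjE)
    fix n L P
    assume L: "L \<in> carrier_mat n n" and P: "P \<in> carrier_mat n n" "positive_definite P"
      and neg: "negative_semidefinite (mat_adjoint L * P + P * L)"
    have "hermitian P" using P by (simp add: positive_definite_def)
    then have diss: "Re ((P *\<^sub>v (L *\<^sub>v x)) \<bullet>c x) \<le> 0" if "x \<in> carrier_vec n" for x
      using negative_semidefinite_lyapunov_iff[OF L P(1)] neg that by blast
    \<comment> \<open>In coordinates orthonormal for \<open>P\<close>, the Lyapunov inequality
      becomes semi-dissipativity.\<close>
    obtain S where S: "S \<in> carrier_mat n n" "mat_adjoint S * (P * S) = 1\<^sub>m n"
      using exists_orthonormal_frame[OF P] by blast
    obtain M where M: "M \<in> carrier_mat n n" "L * S = S * M"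
      using frame_conjugate[OF P(1) S L] by blast
    have "semi_dissipative M"
      by (rule semi_dissipative_frame[OF P(1) S L M diss])
    then have "strongly_stable_wrt s a b {M}"
      using strongly_stable_wrt_semi_dissipative st M(1) by blast
    then show "\<exists>\<tau>\<^sub>0 > 0. \<forall>\<tau>. 0 < \<tau> \<and> \<tau> \<le> \<tau>\<^sub>0 \<longrightarrow>
        (\<forall>u \<in> carrier_vec n. weighted_norm P (rk_step s a b L \<tau> u) \<le> weighted_norm P u)"
      by (rule weighted_contractive_frame[OF P(1) S L M])
  qed
qed

end
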